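(* Let $T>0$ and let $\{X_t\}_{t\in[0,T]}$ be a Responsive Fractional Brownian Motion. For any Borel set $I\subset\mathbb{R}$ and any $t\in(0,T]$, let $\mu_I(t):=\frac1t\int_0^t\mathbf{1}_{\{X_s\in I\}}\,ds$ and $\mathcal{V}_I(t):=\mathrm{Var}[\mu_I(t)]$. Then $$\mathcal{V}_I(t)=\frac1{t^2}\int_0^t\int_0^t\mathrm{Cov}\left(\mathbf{1}_{\{X_u\in I\}},\mathbf{1}_{\{X_v\in I\}}\right)du\,dv,$$ and equivalently $$\mathcal{V}_I(t)=\frac1{t^2}\int_0^t\int_0^t\left[\mathbb{P}(X_u\in I,X_v\in I)-\mathbb{P}(X_u\in I)\,\mathbb{P}(X_v\in I)\right]du\,dv.$$
   Context: Lipschitz-Hölder response function: $H:[0,T]\times\mathbb{R}\to(0,1)$ such that there are constants $L_H>0$, $C_H>0$, $\gamma\in(0,1]$, $0<h_{\min}\le h_{\max}<1$ with, for all $t,s\in[0,T]$, $x,y\in\mathbb{R}$: (i) $|H(t,x)-H(t,y)|\le L_H|x-y|$; (ii) $|H(t,x)-H(s,x)|\le C_H|t-s|^\gamma$; (iii) $h_{\min}\le H(t,x)\le h_{\max}$. Responsive Fractional Brownian Motion (RfBm): on a filtered probability space $(\Omega,\mathcal{F},(\mathcal{F}_t)_{t\in[0,T]},\mathbb{P})$ satisfying the usual conditions with a standard $(\mathcal{F}_t)$-Brownian motion $B$, and given a Lipschitz-Hölder response function $H$, an $(\mathcal{F}_t)$-adapted process $\{X_t\}_{t\in[0,T]}$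 with almost surely continuous paths such that for each $t\in[0,T]$ the Itô integral below is well-defined and, $\mathbb{P}$-almost surely, $$X_t=\int_0^t\sqrt{2H(s,X_s)}\,(t-s)^{H(s,X_s)-1/2}\,dB(s).$$ The quantity $\mu_I(t)$ is called the mean attention intensity and $\mathcal{V}_I(t)$ the temporal volatility functional. *)

theory Defs
  imports "HOL-Probability.Probability"
begin

definition lipschitz_hoelder_response :: "real \<Rightarrow> (real \<Rightarrow> real \<Rightarrow> real) \<Rightarrow> bool" where
  "lipschitz_hoelder_response T H \<longleftrightarrow>
     (\<exists>L C \<gamma> hmin hmax.
        0 < L \<and> 0 < C \<and> 0 < \<gamma> \<and> \<gamma> \<le> 1 \<and> 0 < hmin \<and> hmin \<le> hmax \<and> hmax < 1 \<and>
        (\<forall>t\<in>{0..T}. \<forall>x y. \<bar>H t x - H t y\<bar> \<le> L * \<bar>x - y\<bar>) \<and>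
        (\<forall>t\<in>{0..T}. \<forall>s\<in>{0..T}. \<forall>x. \<bar>H t x - H s x\<bar> \<le> C * \<bar>t - s\<bar> powr \<gamma>) \<and>
        (\<forall>t\<in>{0..T}. \<forall>x. hmin \<le> H t x \<and> H t x \<le> hmax))"

definition filtration_on :: "'a measure \<Rightarrow> real \<Rightarrow> (real \<Rightarrow> 'a measure) \<Rightarrow> bool" where
  "filtration_on M T F \<longleftrightarrow>
     (\<forall>t\<in>{0..T}. subalgebra M (F t)) \<and>
     (\<forall>s\<in>{0..T}. \<forall>t\<in>{s..T}. sets (F s) \<subseteq> sets (F t))"

definition usual_conditions :: "'a measure \<Rightarrow> real \<Rightarrow> (real \<Rightarrow> 'a measure) \<Rightarrow> bool" where
  "usual_conditions M T F \<longleftrightarrow>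
     complete_measure M \<and> null_sets M \<subseteq> sets (F 0) \<and>
     (\<forall>s\<in>{0..<T}. sets (F s) = (\<Inter>t\<in>{s<..T}. sets (F t)))"

definition adapted_on :: "real \<Rightarrow> (real \<Rightarrow> 'a measure) \<Rightarrow> (real \<Rightarrow> 'a \<Rightarrow> real) \<Rightarrow> bool" where
  "adapted_on T F X \<longleftrightarrow> (\<forall>t\<in>{0..T}. X t \<in> borel_measurable (F t))"

definition brownian_motion_on ::
    "'a measure \<Rightarrow> real \<Rightarrow> (real \<Rightarrow> 'a measure) \<Rightarrow> (real \<Rightarrow> 'a \<Rightarrow> real) \<Rightarrow> bool" where
  "brownian_motion_on M T F B \<longleftrightarrow>
     adapted_on T F B \<and>
     (AE \<omega> in M. B 0 \<omega> = 0) \<and>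
     (AE \<omega> in M. continuous_on {0..T} (\<lambda>t. B t \<omega>)) \<and>
     (\<forall>s t. 0 \<le> s \<and> s < t \<and> t \<le> T \<longrightarrow>
        distributed M lborel (\<lambda>\<omega>. B t \<omega> - B s \<omega>) (normal_density 0 (sqrt (t - s))) \<and>
        prob_space.indep_set M (sets (F s))
          {(\<lambda>\<omega>. B t \<omega> - B s \<omega>) -` A \<inter> space M | A. A \<in> sets borel})"

text \<open>
  A simple integrand on \<open>[0,t]\<close> is given by partition points \<open>\<tau> 0 \<le> \<dots> \<le> \<tau> n\<close> in \<open>[0,t]\<close> and
  bounded weights, the weight \<open>\<xi> i\<close> being measurable at the left endpoint of
  \<open>(\<tau> i, \<tau> (i + 1)]\<close>.
\<close>

definition simple_integrand ::
    "'a measure \<Rightarrow> (real \<Rightarrow> 'a measure) \<Rightarrow> real \<Rightarrow> nat \<Rightarrow> (nat \<Rightarrow> real) \<Rightarrow> (nat \<Rightarrow> 'a \<Rightarrow> real) \<Rightarrow> bool" where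
  "simple_integrand M F t n \<tau> \<xi> \<longleftrightarrow>
     (\<forall>i\<le>n. \<tau> i \<in> {0..t}) \<and> (\<forall>i<n. \<tau> i \<le> \<tau> (Suc i)) \<and>
     (\<forall>i<n. \<xi> i \<in> borel_measurable (F (\<tau> i)) \<and> (\<exists>K. \<forall>\<omega>\<in>space M. \<bar>\<xi> i \<omega>\<bar> \<le> K))"

definition simple_value ::
    "nat \<Rightarrow> (nat \<Rightarrow> real) \<Rightarrow> (nat \<Rightarrow> 'a \<Rightarrow> real) \<Rightarrow> real \<Rightarrow> 'a \<Rightarrow> real" where
  "simple_value n \<tau> \<xi> s \<omega> = (\<Sum>i<n. \<xi> i \<omega> * indicator {\<tau> i<..\<tau> (Suc i)} s)"

definition simple_integral ::
    "(real \<Rightarrow> 'a \<Rightarrow> real) \<Rightarrow> nat \<Rightarrow> (nat \<Rightarrow> real) \<Rightarrow> (nat \<Rightarrow> 'a \<Rightarrow> real) \<Rightarrow> 'a \<Rightarrow> real" where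
  "simple_integral B n \<tau> \<xi> \<omega> = (\<Sum>i<n. \<xi> i \<omega> * (B (\<tau> (Suc i)) \<omega> - B (\<tau> i) \<omega>))"

text \<open>
  The product of Lebesgue measure on \<open>[0,t]\<close> and the probability measure. It is completed so that
  an integrand built from a process whose paths are only almost surely continuous is still
  measurable: nothing is known about the paths on the exceptional null set.
\<close>

definition time_prob :: "'a measure \<Rightarrow> real \<Rightarrow> (real \<times> 'a) measure" where
  "time_prob M t = completion (restrict_space lborel {0..t} \<Otimes>\<^sub>M M)"

text \<open>
  \<open>has_ito_integral M F B t \<phi> Y\<close>: the Ito integral of \<open>\<phi>\<close> against \<open>B\<close> over \<open>[0,t]\<close> is well-defined
  (\<open>\<phi>\<close> is adapted, measurable and square integrable) and \<open>Y\<close> is a version of it, i.e. the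
  mean-square limit of the integrals of simple integrands approximating \<open>\<phi>\<close>. By the Ito isometry
  \<open>Y\<close> is determined up to a null set and does not depend on the approximating sequence. The
  localised integral is not needed for responsive fractional Brownian motion: as the response
  function takes values in \<open>[hmin, hmax]\<close> with \<open>0 < hmin\<close>, its kernel is always square integrable.
\<close>

definition has_ito_integral ::
    "'a measure \<Rightarrow> (real \<Rightarrow> 'a measure) \<Rightarrow> (real \<Rightarrow> 'a \<Rightarrow> real) \<Rightarrow> real \<Rightarrow>
     (real \<Rightarrow> 'a \<Rightarrow> real) \<Rightarrow> ('a \<Rightarrow> real) \<Rightarrow> bool" where
  "has_ito_integral M F B t \<phi> Y \<longleftrightarrow>
     adapted_on t F \<phi> \<and>
     (\<lambda>(s, \<omega>). \<phi> s \<omega>) \<in> borel_measurable (time_prob M t) \<and>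
     (\<integral>\<^sup>+ (s, \<omega>). ennreal ((\<phi> s \<omega>)\<^sup>2) \<partial>time_prob M t) < \<infinity> \<and>
     Y \<in> borel_measurable M \<and>
     (\<exists>n \<tau> \<xi>.
        (\<forall>k. simple_integrand M F t (n k) (\<tau> k) (\<xi> k)) \<and>
        ((\<lambda>k. \<integral>\<^sup>+ (s, \<omega>). ennreal ((simple_value (n k) (\<tau> k) (\<xi> k) s \<omega> - \<phi> s \<omega>)\<^sup>2) \<partial>time_prob M t)
           \<longlonglongrightarrow> 0) \<and>
        ((\<lambda>k. \<integral>\<^sup>+ \<omega>. ennreal ((simple_integral B (n k) (\<tau> k) (\<xi> k) \<omega> - Y \<omega>)\<^sup>2) \<partial>M) \<longlonglongrightarrow> 0))"

definition rfbm_kernel ::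
    "(real \<Rightarrow> real \<Rightarrow> real) \<Rightarrow> (real \<Rightarrow> 'a \<Rightarrow> real) \<Rightarrow> real \<Rightarrow> real \<Rightarrow> 'a \<Rightarrow> real" where
  "rfbm_kernel H X t s \<omega> = sqrt (2 * H s (X s \<omega>)) * (t - s) powr (H s (X s \<omega>) - 1 / 2)"

definition rfbm ::
    "'a measure \<Rightarrow> real \<Rightarrow> (real \<Rightarrow> 'a measure) \<Rightarrow> (real \<Rightarrow> 'a \<Rightarrow> real) \<Rightarrow>
     (real \<Rightarrow> real \<Rightarrow> real) \<Rightarrow> (real \<Rightarrow> 'a \<Rightarrow> real) \<Rightarrow> bool" where
  "rfbm M T F B H X \<longleftrightarrow>
     prob_space M \<and> filtration_on M T F \<and> usual_conditions M T F \<and>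
     brownian_motion_on M T F B \<and> lipschitz_hoelder_response T H \<and>
     adapted_on T F X \<and>
     (AE \<omega> in M. continuous_on {0..T} (\<lambda>t. X t \<omega>)) \<and>
     (\<forall>t\<in>{0..T}. \<exists>Y. has_ito_integral M F B t (rfbm_kernel H X t) Y \<and> (AE \<omega> in M. X t \<omega> = Y \<omega>))"

definition mean_attention_intensity ::
    "(real \<Rightarrow> 'a \<Rightarrow> real) \<Rightarrow> real set \<Rightarrow> real \<Rightarrow> 'a \<Rightarrow> real" where
  "mean_attention_intensity X I t \<omega> = (1 / t) * (LINT s:{0..t}|lborel. indicator I (X s \<omega>))"

definition temporal_volatility ::
    "'a measure \<Rightarrow> (real \<Rightarrow> 'a \<Rightarrow> real) \<Rightarrow> real set \<Rightarrow> real \<Rightarrow> real" where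
  "temporal_volatility M X I t = prob_space.variance M (mean_attention_intensity X I t)"

definition covariance :: "'a measure \<Rightarrow> ('a \<Rightarrow> real) \<Rightarrow> ('a \<Rightarrow> real) \<Rightarrow> real" where
  "covariance M Y Z =
     prob_space.expectation M
       (\<lambda>\<omega>. (Y \<omega> - prob_space.expectation M Y) * (Z \<omega> - prob_space.expectation M Z))"

end

theory Submission
  imports Defs
begin

text \<open>
  The identity is Fubini's theorem. Write \<open>G s = indicator I (X s)\<close>, \<open>D s = G s - E (G s)\<close> and
  \<open>Z = \<integral>\<^sub>0\<^sup>t G s ds\<close>. One use of Fubini gives \<open>Z - E Z = \<integral>\<^sub>0\<^sup>t D s ds\<close>, so that
  \<open>(Z - E Z)\<^sup>2 = \<integral>\<^sub>0\<^sup>t \<integral>\<^sub>0\<^sup>t D u * D v du dv\<close>; moving the expectation inside both integrals turns the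
  integrand into \<open>Cov (G u, G v)\<close>. Everything is bounded and all measures are finite, so
  joint measurability of \<open>G\<close> in time and chance is all that has to be checked. This is
  \<open>variance_integral_eq_covariance_integral\<close>.

  Joint measurability comes from continuity of the paths: a continuous process is the limit of
  its samplings on finer and finer grids. The paths of a responsive fractional Brownian motion
  are continuous only outside a null set, so \<open>X\<close> is first replaced by a process \<open>Y\<close> all of whose
  paths are continuous and which agrees with \<open>X\<close> at all times of \<open>[0, T]\<close> simultaneously, almost
  surely (\<open>continuous_paths_jointly_measurable_version\<close>). Covariances do not see the change,
  nor does the time average, except on a null set, where its values are arbitrary; completeness
  of the probability space makes it a random variable all the same (\<open>measurable_AE_eq\<close>).
\<close>

section \<open>Joint measurability\<close>

text \<open>
  The process is the pointwise limit of \<open>Y (\<lfloor>n s\<rfloor> / n)\<close>, and each of these depends on time only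
  through an integer, hence is measurable by countable gluing.
\<close>

lemma borel_measurable_continuous_process:
  fixes Y :: "real \<Rightarrow> 'a \<Rightarrow> 'b :: metric_space"
  assumes meas: "\<And>s. Y s \<in> borel_measurable M"
    and cont: "\<And>\<omega>. \<omega> \<in> space M \<Longrightarrow> continuous_on UNIV (\<lambda>s. Y s \<omega>)"
  shows "case_prod Y \<in> borel_measurable (borel \<Otimes>\<^sub>M M)"
proof (rule borel_measurable_LIMSEQ_metric)
  fix i :: nat
  have "(\<lambda>p. Y (real_of_int \<lfloor>real (Suc i) * fst p\<rfloor> / real (Suc i)) (snd p))
      \<in> borel_measurable (borel \<Otimes>\<^sub>M M)"
  proof (rule measurable_compose_countable[where f = "\<lambda>k p. Y (real_of_int k / real (Suc i)) (snd p)"])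
    show "(\<lambda>p. Y (real_of_int k / real (Suc i)) (snd p)) \<in> borel_measurable (borel \<Otimes>\<^sub>M M)" for k
      using measurable_compose[OF measurable_snd meas] .
  qed measurable
  then show "(\<lambda>p. Y (real_of_int \<lfloor>real (Suc i) * fst p\<rfloor> / real (Suc i)) (snd p))
      \<in> borel_measurable (borel \<Otimes>\<^sub>M M)" .
next
  fix p assume p: "p \<in> space ((borel :: real measure) \<Otimes>\<^sub>M M)"
  have "(\<lambda>i. real_of_int \<lfloor>real (Suc i) * fst p\<rfloor> / real (Suc i)) \<longlonglongrightarrow> fst p"
  proof (rule tendsto_sandwich)
    show "\<forall>\<^sub>F i in sequentially. fst p - 1 / real (Suc i) \<le> real_of_int \<lfloor>real (Suc i) * fst p\<rfloor> / real (Suc i)"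
    proof (intro always_eventually allI)
      fix i
      have "real (Suc i) * fst p - 1 \<le> real_of_int \<lfloor>real (Suc i) * fst p\<rfloor>" by linarith
      then have "(real (Suc i) * fst p - 1) / real (Suc i) \<le> real_of_int \<lfloor>real (Suc i) * fst p\<rfloor> / real (Suc i)"
        by (rule divide_right_mono) simp
      then show "fst p - 1 / real (Suc i) \<le> real_of_int \<lfloor>real (Suc i) * fst p\<rfloor> / real (Suc i)"
        by (simp add: diff_divide_distrib del: of_nat_Suc)
    qed
    show "\<forall>\<^sub>F i in sequentially. real_of_int \<lfloor>real (Suc i) * fst p\<rfloor> / real (Suc i) \<le> fst p"
    proof (intro always_eventually allI)
      fix i
      have "real_of_int \<lfloor>real (Suc i) * fst p\<rfloor> \<le> real (Suc i) * fst p" by linarith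
      then show "real_of_int \<lfloor>real (Suc i) * fst p\<rfloor> / real (Suc i) \<le> fst p"
        by (simp add: field_simps)
    qed
    show "(\<lambda>i. fst p - 1 / real (Suc i)) \<longlonglongrightarrow> fst p"
      using tendsto_diff[OF tendsto_const LIMSEQ_Suc[OF lim_1_over_n]] by simp
  qed simp
  moreover have "isCont (\<lambda>s. Y s (snd p)) (fst p)"
    using cont[of "snd p"] p by (auto simp: space_pair_measure continuous_on_eq_continuous_at)
  ultimately have "(\<lambda>i. Y (real_of_int \<lfloor>real (Suc i) * fst p\<rfloor> / real (Suc i)) (snd p)) \<longlonglongrightarrow> Y (fst p) (snd p)"
    by (rule isCont_tendsto_compose[rotated])
  then show "(\<lambda>i. Y (real_of_int \<lfloor>real (Suc i) * fst p\<rfloor> / real (Suc i)) (snd p)) \<longlonglongrightarrow> case_prod Y p"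
    by (simp add: case_prod_beta)
qed

text \<open>
  A preimage under \<open>g\<close> differs from the one under \<open>f\<close> by a subset of a null set, which a complete
  measure measures.
\<close>

lemma (in complete_measure) measurable_AE_eq:
  assumes f: "f \<in> measurable M N" and g: "g \<in> space M \<rightarrow> space N"
    and eq: "AE \<omega> in M. f \<omega> = g \<omega>"
  shows "g \<in> measurable M N"
proof (rule measurableI)
  fix A assume "A \<in> sets N"
  with f have "f -` A \<inter> space M \<in> sets M" by (rule measurable_sets)
  then show "g -` A \<inter> space M \<in> sets M"
    by (rule in_sets_AE[rotated]) (use eq in auto)
qed (use g in auto)

text \<open>
  All discontinuous paths lie over one null set, and the process is set to zero there. As this null
  set serves all times, the agreement is of whole paths, which is what a time average needs.
\<close>

lemma continuous_paths_jointly_measurable_version: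
  fixes X :: "real \<Rightarrow> 'a \<Rightarrow> real"
  assumes T: "0 \<le> T" and X: "\<And>s. s \<in> {0..T} \<Longrightarrow> X s \<in> borel_measurable M"
    and cont: "AE \<omega> in M. continuous_on {0..T} (\<lambda>s. X s \<omega>)"
  obtains Y where "case_prod Y \<in> borel_measurable (borel \<Otimes>\<^sub>M M)"
    and "AE \<omega> in M. \<forall>s\<in>{0..T}. X s \<omega> = Y s \<omega>"
proof -
  from cont obtain N where N: "\<And>\<omega>. \<omega> \<in> space M - N \<Longrightarrow> continuous_on {0..T} (\<lambda>s. X s \<omega>)"
    and null: "N \<in> null_sets M"
    by (rule AE_E3) blast
  \<comment> \<open>Freezing the path outside \<open>[0, T]\<close> extends it continuously to the whole line.\<close>
  define Y where "Y s \<omega> = (if \<omega> \<in> N then 0 else X (max 0 (min T s)) \<omega>)" for s \<omega>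
  have clamp: "max 0 (min T s) \<in> {0..T}" for s
    using T by auto
  have "case_prod Y \<in> borel_measurable (borel \<Otimes>\<^sub>M M)"
  proof (rule borel_measurable_continuous_process)
    fix s
    have [measurable]: "N \<in> sets M" "X (max 0 (min T s)) \<in> borel_measurable M"
      using null X[OF clamp] by auto
    show "Y s \<in> borel_measurable M"
      unfolding Y_def by measurable
  next
    fix \<omega> assume "\<omega> \<in> space M"
    show "continuous_on UNIV (\<lambda>s. Y s \<omega>)"
    proof (cases "\<omega> \<in> N")
      case False
      have "continuous_on UNIV (\<lambda>s. X (max 0 (min T s)) \<omega>)"
        by (rule continuous_on_compose2[OF N[of \<omega>], where f = "\<lambda>s. max 0 (min T s)"])
          (use False \<open>\<omega> \<in> space M\<close> clamp in \<open>auto intro!: continuous_intros\<close>)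
      with False show ?thesis by (simp add: Y_def)
    qed (simp add: Y_def)
  qed
  moreover have "AE \<omega> in M. \<forall>s\<in>{0..T}. X s \<omega> = Y s \<omega>"
    using AE_not_in[OF null] by eventually_elim (simp add: Y_def)
  ultimately show thesis by (rule that)
qed

section \<open>Covariances\<close>

lemma covariance_cong_AE:
  assumes [measurable]: "Y \<in> borel_measurable M" "Z \<in> borel_measurable M"
    "Y' \<in> borel_measurable M" "Z' \<in> borel_measurable M"
    and Y: "AE \<omega> in M. Y \<omega> = Y' \<omega>" and Z: "AE \<omega> in M. Z \<omega> = Z' \<omega>"
  shows "covariance M Y Z = covariance M Y' Z'"
proof -
  have "integral\<^sup>L M Y = integral\<^sup>L M Y'" "integral\<^sup>L M Z = integral\<^sup>L M Z'"
    using Y Z by (auto intro!: integral_cong_AE)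
  then show ?thesis
    unfolding covariance_def using Y Z by (auto intro!: integral_cong_AE)
qed

lemma (in prob_space) covariance_indicator:
  assumes [measurable]: "A \<in> events" "B \<in> events"
  shows "covariance M (indicator A) (indicator B) = prob (A \<inter> B) - prob A * prob B"
proof -
  have "covariance M (indicator A) (indicator B) =
      expectation (\<lambda>\<omega>. indicator (A \<inter> B) \<omega> - prob B * indicator A \<omega> - prob A * indicator B \<omega> + prob A * prob B)"
    unfolding covariance_def
    by (intro Bochner_Integration.integral_cong)
      (auto simp: Int_absorb2 sets.sets_into_space split: split_indicator, auto simp: algebra_simps)
  also have "\<dots> = prob (A \<inter> B) - prob A * prob B"
    by (simp add: Int_absorb2 sets.sets_into_space prob_space emeasure_eq_measure less_top[symmetric])
  finally show ?thesis .
qed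

lemma (in prob_space) borel_measurable_covariance:
  assumes [measurable]: "case_prod G \<in> borel_measurable (L \<Otimes>\<^sub>M M)"
  shows "(\<lambda>(u, v). covariance M (G u) (G v)) \<in> borel_measurable (L \<Otimes>\<^sub>M L)"
  unfolding covariance_def by measurable

lemma (in prob_space) abs_expectation_le:
  fixes f :: "'a \<Rightarrow> real"
  assumes [measurable]: "f \<in> borel_measurable M"
    and K: "\<And>\<omega>. \<omega> \<in> space M \<Longrightarrow> \<bar>f \<omega>\<bar> \<le> K"
  shows "\<bar>expectation f\<bar> \<le> K"
proof -
  have "integrable M f"
    by (rule integrable_const_bound[where B = K]) (use K in auto)
  moreover have "f \<omega> \<le> K" "- K \<le> f \<omega>" if "\<omega> \<in> space M" for \<omega>
    using K[OF that] by auto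
  ultimately have "expectation f \<le> K" "- K \<le> expectation f"
    by (auto intro!: integral_le_const integral_ge_const)
  then show ?thesis by (simp add: abs_le_iff)
qed

lemma (in prob_space) covariance_bounded:
  assumes [measurable]: "Y \<in> borel_measurable M" "Z \<in> borel_measurable M"
    and Y: "\<And>\<omega>. \<omega> \<in> space M \<Longrightarrow> \<bar>Y \<omega>\<bar> \<le> K" and Z: "\<And>\<omega>. \<omega> \<in> space M \<Longrightarrow> \<bar>Z \<omega>\<bar> \<le> K"
  shows "\<bar>covariance M Y Z\<bar> \<le> (2 * K)\<^sup>2"
  unfolding covariance_def
proof (rule abs_expectation_le)
  fix \<omega> assume \<omega>: "\<omega> \<in> space M"
  have "\<bar>Y \<omega> - expectation Y\<bar> \<le> 2 * K" "\<bar>Z \<omega> - expectation Z\<bar> \<le> 2 * K"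
    using Y[OF \<omega>] Z[OF \<omega>] abs_expectation_le[OF assms(1) Y] abs_expectation_le[OF assms(2) Z]
    by linarith+
  then have "\<bar>Y \<omega> - expectation Y\<bar> * \<bar>Z \<omega> - expectation Z\<bar> \<le> (2 * K) * (2 * K)"
    by (rule mult_mono') auto
  then show "\<bar>(Y \<omega> - expectation Y) * (Z \<omega> - expectation Z)\<bar> \<le> (2 * K)\<^sup>2"
    by (simp add: abs_mult power2_eq_square)
qed measurable

section \<open>Variance of a time integral\<close>

text \<open>
  This is the continuous form of the rule that the variance of a sum is the sum of all pairwise
  covariances.
  Centring before squaring makes the covariance appear as the expectation of one product, so no
  square has to be expanded and no integrals have to be subtracted in the double integral.
\<close>

lemma (in prob_space) variance_integral_eq_covariance_integral:
  assumes "finite_measure N"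
    and [measurable]: "case_prod G \<in> borel_measurable (N \<Otimes>\<^sub>M M)"
    and K: "\<And>s \<omega>. s \<in> space N \<Longrightarrow> \<omega> \<in> space M \<Longrightarrow> \<bar>G s \<omega>\<bar> \<le> K"
  shows "integrable M (\<lambda>\<omega>. \<integral>s. G s \<omega> \<partial>N)"
    and "integrable M (\<lambda>\<omega>. (\<integral>s. G s \<omega> \<partial>N)\<^sup>2)"
    and "variance (\<lambda>\<omega>. \<integral>s. G s \<omega> \<partial>N) = (\<integral>v. (\<integral>u. covariance M (G u) (G v) \<partial>N) \<partial>N)"
proof -
  interpret N: finite_measure N by fact
  interpret P: pair_sigma_finite N M ..
  interpret NM: finite_measure "N \<Otimes>\<^sub>M M"
    by (intro finite_measure_pair_measure) unfold_locales
  have G_meas: "G s \<in> borel_measurable M" if "s \<in> space N" for s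
    using measurable_Pair2[OF assms(2) that] by simp
  have bound: "\<bar>\<integral>s. f s \<partial>N\<bar> \<le> C * measure N (space N)"
    if "f \<in> borel_measurable N" "\<And>s. s \<in> space N \<Longrightarrow> \<bar>f s\<bar> \<le> C" for f :: "'b \<Rightarrow> real" and C
  proof -
    have "\<bar>\<integral>s. f s \<partial>N\<bar> \<le> (\<integral>s. \<bar>f s\<bar> \<partial>N)" by (rule integral_abs_bound)
    also have "\<dots> \<le> (\<integral>s. C \<partial>N)"
      using that by (intro integral_mono integrable_abs N.integrable_const_bound[where B = C and f = f]) auto
    finally show ?thesis by (simp add: mult.commute)
  qed
  have fubini: "(\<integral>\<omega>. (\<integral>s. f s \<omega> \<partial>N) \<partial>M) = (\<integral>s. (\<integral>\<omega>. f s \<omega> \<partial>M) \<partial>N)"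
    if "case_prod f \<in> borel_measurable (N \<Otimes>\<^sub>M M)"
      and "\<And>s \<omega>. s \<in> space N \<Longrightarrow> \<omega> \<in> space M \<Longrightarrow> \<bar>f s \<omega>\<bar> \<le> C" for f :: "'b \<Rightarrow> 'a \<Rightarrow> real" and C
    using that by (intro P.Fubini_integral NM.integrable_const_bound[where B = C])
      (auto simp: space_pair_measure)
  have Z_le: "\<bar>\<integral>s. G s \<omega> \<partial>N\<bar> \<le> K * measure N (space N)" if "\<omega> \<in> space M" for \<omega>
    by (rule bound) (use that K measurable_Pair1[OF assms(2) that] in auto)
  show "integrable M (\<lambda>\<omega>. \<integral>s. G s \<omega> \<partial>N)"
    by (rule integrable_const_bound[where B = "K * measure N (space N)"])
      (auto intro!: AE_I2 Z_le)
  show "integrable M (\<lambda>\<omega>. (\<integral>s. G s \<omega> \<partial>N)\<^sup>2)"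
    by (rule integrable_const_bound[where B = "(K * measure N (space N))\<^sup>2"])
      (use power_mono[OF Z_le, of _ 2] in auto)
  define D where "D s \<omega> = G s \<omega> - expectation (G s)" for s \<omega>
  have [measurable]: "case_prod D \<in> borel_measurable (N \<Otimes>\<^sub>M M)"
    unfolding D_def by measurable
  have D: "\<bar>D s \<omega>\<bar> \<le> 2 * K" if "s \<in> space N" "\<omega> \<in> space M" for s \<omega>
    using K[OF that] abs_expectation_le[OF G_meas[OF that(1)] K[OF that(1)]] unfolding D_def by linarith
  have DD: "\<bar>D u \<omega> * D v \<omega>\<bar> \<le> 2 * K * (2 * K)" if "u \<in> space N" "v \<in> space N" "\<omega> \<in> space M" for u v \<omega>
    unfolding abs_mult by (rule mult_mono') (use D that in auto)
  have centred: "(\<integral>s. G s \<omega> \<partial>N) - expectation (\<lambda>\<omega>. \<integral>s. G s \<omega> \<partial>N) = (\<integral>s. D s \<omega> \<partial>N)"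
    if [simp]: "\<omega> \<in> space M" for \<omega>
  proof -
    have "integrable N (\<lambda>s. G s \<omega>)" "integrable N (\<lambda>s. expectation (G s))"
      by (rule N.integrable_const_bound[where B = K]; auto intro!: AE_I2 K abs_expectation_le G_meas)+
    moreover have "expectation (\<lambda>\<omega>. \<integral>s. G s \<omega> \<partial>N) = (\<integral>s. expectation (G s) \<partial>N)"
      by (rule fubini[of _ K]) (auto intro: K)
    ultimately show ?thesis unfolding D_def by simp
  qed
  have "variance (\<lambda>\<omega>. \<integral>s. G s \<omega> \<partial>N) = (\<integral>\<omega>. (\<integral>v. (\<integral>u. D u \<omega> * D v \<omega> \<partial>N) \<partial>N) \<partial>M)"
    by (intro Bochner_Integration.integral_cong) (simp_all add: centred power2_eq_square)
  \<comment> \<open>The expectation passes the two time integrals one at a time.\<close>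
  also have "\<dots> = (\<integral>v. (\<integral>\<omega>. (\<integral>u. D u \<omega> * D v \<omega> \<partial>N) \<partial>M) \<partial>N)"
    by (rule fubini[of _ "2 * K * (2 * K) * measure N (space N)"]) (measurable, intro bound DD, auto)
  also have "\<dots> = (\<integral>v. (\<integral>u. (\<integral>\<omega>. D u \<omega> * D v \<omega> \<partial>M) \<partial>N) \<partial>N)"
    by (intro Bochner_Integration.integral_cong refl fubini[of _ "2 * K * (2 * K)"])
      (use DD in auto)
  finally show "variance (\<lambda>\<omega>. \<integral>s. G s \<omega> \<partial>N) = (\<integral>v. (\<integral>u. covariance M (G u) (G v) \<partial>N) \<partial>N)"
    unfolding covariance_def D_def .
qed

section \<open>Attention of responsive fractional Brownian motion\<close>

theorem theorem6p2:
  fixes M :: "'a measure" and T t :: real and F :: "real \<Rightarrow> 'a measure"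
    and B X :: "real \<Rightarrow> 'a \<Rightarrow> real" and H :: "real \<Rightarrow> real \<Rightarrow> real" and I :: "real set"
  assumes "T > 0" and "rfbm M T F B H X" and "I \<in> sets borel" and "t \<in> {0<..T}"
  shows "(AE \<omega> in M. set_integrable lborel {0..t} (\<lambda>s. indicator I (X s \<omega>) :: real)) \<and>
    integrable M (mean_attention_intensity X I t) \<and>
    integrable M (\<lambda>\<omega>. (mean_attention_intensity X I t \<omega>)\<^sup>2) \<and>
    set_integrable lborel ({0..t} \<times> {0..t})
      (\<lambda>(u, v). covariance M (\<lambda>\<omega>. indicator I (X u \<omega>)) (\<lambda>\<omega>. indicator I (X v \<omega>))) \<and>
    temporal_volatility M X I t =
      1 / t\<^sup>2 * (LINT v:{0..t}|lborel. (LINT u:{0..t}|lborel.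
        covariance M (\<lambda>\<omega>. indicator I (X u \<omega>)) (\<lambda>\<omega>. indicator I (X v \<omega>)))) \<and>
    temporal_volatility M X I t =
      1 / t\<^sup>2 * (LINT v:{0..t}|lborel. (LINT u:{0..t}|lborel.
        \<P>(\<omega> in M. X u \<omega> \<in> I \<and> X v \<omega> \<in> I) - \<P>(\<omega> in M. X u \<omega> \<in> I) * \<P>(\<omega> in M. X v \<omega> \<in> I)))"
proof -
  from assms(2) have "prob_space M" "complete_measure M"
    and sub: "\<And>s. s \<in> {0..T} \<Longrightarrow> subalgebra M (F s)"
    and adapted: "\<And>s. s \<in> {0..T} \<Longrightarrow> X s \<in> borel_measurable (F s)"
    and cont: "AE \<omega> in M. continuous_on {0..T} (\<lambda>s. X s \<omega>)"
    by (auto simp: rfbm_def usual_conditions_def filtration_on_def adapted_on_def)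
  interpret prob_space M by fact
  interpret complete_measure M by fact
  from assms(4) have t: "0 < t" "t \<le> T" by auto
  have [measurable]: "I \<in> sets borel" by fact
  have X_meas: "X s \<in> borel_measurable M" if "s \<in> {0..T}" for s
    using measurable_from_subalg[OF sub[OF that] adapted[OF that]] .
  obtain Y where Y [measurable]: "case_prod Y \<in> borel_measurable (borel \<Otimes>\<^sub>M M)"
    and XY: "AE \<omega> in M. \<forall>s\<in>{0..T}. X s \<omega> = Y s \<omega>"
    by (rule continuous_paths_jointly_measurable_version[OF _ X_meas cont]) (use assms(1) in auto)
  define G :: "real \<Rightarrow> 'a \<Rightarrow> real" where "G s \<omega> = indicator I (Y s \<omega>)" for s \<omega>
  have G [measurable]: "case_prod G \<in> borel_measurable (borel \<Otimes>\<^sub>M M)"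
    unfolding G_def by measurable
  have G_sec: "G s \<in> borel_measurable M" for s
    using measurable_Pair2[OF G, of s] by simp
  have G_le: "\<bar>G s \<omega>\<bar> \<le> 1" for s \<omega>
    by (simp add: G_def)
  let ?L = "restrict_space lborel {0..t}"
  have to_L: "(LINT s:{0..t}|lborel. f s) = (\<integral>s. f s \<partial>?L)" for f :: "real \<Rightarrow> real"
    by (simp add: set_lebesgue_integral_def integral_restrict_space)
  have fin: "finite_measure ?L"
    by (rule finite_measureI) (use t in \<open>simp add: emeasure_restrict_space\<close>)
  have [measurable]: "(\<lambda>s. s) \<in> measurable ?L borel"
    by (rule measurable_restrict_space1) simp
  have "(\<lambda>p. (fst p, snd p)) \<in> measurable (?L \<Otimes>\<^sub>M M) (borel \<Otimes>\<^sub>M M)"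
    by measurable
  from measurable_compose[OF this G] have GL: "case_prod G \<in> borel_measurable (?L \<Otimes>\<^sub>M M)"
    by (simp add: case_prod_beta')
  define Z where "Z \<omega> = (\<integral>s. G s \<omega> \<partial>?L)" for \<omega>
  note Z = variance_integral_eq_covariance_integral[OF fin GL, of 1, folded Z_def, OF G_le]
  let ?\<mu> = "mean_attention_intensity X I t"
  have mu_Z: "AE \<omega> in M. 1 / t * Z \<omega> = ?\<mu> \<omega>"
    using XY
  proof eventually_elim
    case (elim \<omega>)
    have "Z \<omega> = (LINT s:{0..t}|lborel. indicator I (X s \<omega>))"
      unfolding to_L Z_def
      by (intro Bochner_Integration.integral_cong refl) (use elim t in \<open>auto simp: G_def\<close>)
    then show ?case by (simp add: mean_attention_intensity_def)
  qed
  have Z_meas [measurable]: "Z \<in> borel_measurable M"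
    using Z(1) by auto
  have mu_meas [measurable]: "?\<mu> \<in> borel_measurable M"
    by (rule measurable_AE_eq[OF _ _ mu_Z]) auto
  have "AE \<omega> in M. set_integrable lborel {0..t} (\<lambda>s. indicator I (X s \<omega>) :: real)"
    using XY AE_space
  proof eventually_elim
    case (elim \<omega>)
    have "set_integrable lborel {0..t} (\<lambda>s. G s \<omega>)"
      unfolding set_integrable_def
      by (rule integrableI_bounded_set_indicator[where B = 1])
        (use measurable_Pair1[OF G, of \<omega>] elim t in \<open>auto simp: G_le\<close>)
    also have "?this \<longleftrightarrow> ?case"
      by (intro set_integrable_cong refl) (use elim t in \<open>auto simp: G_def\<close>)
    finally show ?case .
  qed
  moreover have "integrable M ?\<mu>"
    using Z(1) by (rule integrable_cong_AE_imp[OF integrable_mult_right[of "1 / t"]]) (use mu_Z in auto)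
  moreover have "integrable M (\<lambda>\<omega>. (?\<mu> \<omega>)\<^sup>2)"
  proof (rule integrable_cong_AE_imp[OF integrable_mult_right[of "1 / t\<^sup>2", OF Z(2)]])
    show "AE \<omega> in M. 1 / t\<^sup>2 * (Z \<omega>)\<^sup>2 = (?\<mu> \<omega>)\<^sup>2"
      using mu_Z by eventually_elim (metis power_mult_distrib power_one_over)
  qed measurable
  moreover have cov: "covariance M (\<lambda>\<omega>. indicator I (X u \<omega>)) (\<lambda>\<omega>. indicator I (X v \<omega>)) = covariance M (G u) (G v)"
    if "u \<in> {0..t}" "v \<in> {0..t}" for u v
  proof (rule covariance_cong_AE)
    have [measurable]: "X u \<in> borel_measurable M" "X v \<in> borel_measurable M"
      using X_meas that t by auto
    show "(\<lambda>\<omega>. indicator I (X u \<omega>)) \<in> borel_measurable M" "(\<lambda>\<omega>. indicator I (X v \<omega>)) \<in> borel_measurable M"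
      by measurable
    show "AE \<omega> in M. indicator I (X u \<omega>) = G u \<omega>" "AE \<omega> in M. indicator I (X v \<omega>) = G v \<omega>"
      using XY that t by (auto simp: G_def elim!: eventually_mono)
  qed (rule G_sec)+
  moreover have "set_integrable lborel ({0..t} \<times> {0..t})
      (\<lambda>(u, v). covariance M (\<lambda>\<omega>. indicator I (X u \<omega>)) (\<lambda>\<omega>. indicator I (X v \<omega>)))"
  proof -
    have "set_integrable lborel ({0..t} \<times> {0..t}) (\<lambda>(u, v). covariance M (G u) (G v))"
      unfolding set_integrable_def
    proof (rule integrableI_bounded_set_indicator)
      show "(\<lambda>(u, v). covariance M (G u) (G v)) \<in> borel_measurable lborel"
        using borel_measurable_covariance[OF G] by (simp add: borel_prod)
      show "emeasure lborel ({0..t} \<times> {0..t}) < \<infinity>"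
        by (intro emeasure_bounded_finite bounded_Times) auto
      show "AE p in lborel. p \<in> {0..t} \<times> {0..t} \<longrightarrow> norm (case p of (u, v) \<Rightarrow> covariance M (G u) (G v)) \<le> (2 * 1)\<^sup>2"
        using covariance_bounded[OF G_sec G_sec G_le G_le] by (auto simp: split_beta)
    qed (auto intro!: borel_closed closed_Times)
    also have "?this \<longleftrightarrow> ?thesis"
      by (intro set_integrable_cong refl) (auto simp: cov)
    finally show ?thesis .
  qed
  moreover have "temporal_volatility M X I t =
      1 / t\<^sup>2 * (LINT v:{0..t}|lborel. (LINT u:{0..t}|lborel.
        covariance M (\<lambda>\<omega>. indicator I (X u \<omega>)) (\<lambda>\<omega>. indicator I (X v \<omega>))))"
  proof -
    have "temporal_volatility M X I t = covariance M ?\<mu> ?\<mu>"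
      by (simp add: temporal_volatility_def covariance_def power2_eq_square)
    also have "\<dots> = covariance M (\<lambda>\<omega>. 1 / t * Z \<omega>) (\<lambda>\<omega>. 1 / t * Z \<omega>)"
      by (rule covariance_cong_AE) (use mu_Z in auto)
    also have "\<dots> = expectation (\<lambda>\<omega>. 1 / t\<^sup>2 * (Z \<omega> - expectation Z)\<^sup>2)"
      unfolding covariance_def integral_mult_right_zero[where f = Z]
      by (intro Bochner_Integration.integral_cong refl)
        (simp add: power2_eq_square diff_divide_distrib[symmetric])
    also have "\<dots> = 1 / t\<^sup>2 * variance Z"
      by (rule integral_mult_right_zero)
    also have "variance Z = (\<integral>v. (\<integral>u. covariance M (G u) (G v) \<partial>?L) \<partial>?L)"
      by (rule Z(3))
    also have "\<dots> = (LINT v:{0..t}|lborel. (LINT u:{0..t}|lborel.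
        covariance M (\<lambda>\<omega>. indicator I (X u \<omega>)) (\<lambda>\<omega>. indicator I (X v \<omega>))))"
      unfolding to_L by (intro Bochner_Integration.integral_cong refl) (auto simp: cov)
    finally show ?thesis .
  qed
  moreover have "(LINT v:{0..t}|lborel. (LINT u:{0..t}|lborel.
        covariance M (\<lambda>\<omega>. indicator I (X u \<omega>)) (\<lambda>\<omega>. indicator I (X v \<omega>)))) =
      (LINT v:{0..t}|lborel. (LINT u:{0..t}|lborel.
        \<P>(\<omega> in M. X u \<omega> \<in> I \<and> X v \<omega> \<in> I) - \<P>(\<omega> in M. X u \<omega> \<in> I) * \<P>(\<omega> in M. X v \<omega> \<in> I)))"
    unfolding to_L
  proof (intro Bochner_Integration.integral_cong refl)
    fix v u assume "v \<in> space ?L" "u \<in> space ?L"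
    then have [measurable]: "X u \<in> borel_measurable M" "X v \<in> borel_measurable M"
      using X_meas t by auto
    let ?A = "\<lambda>s. {\<omega> \<in> space M. X s \<omega> \<in> I}"
    have "covariance M (\<lambda>\<omega>. indicator I (X u \<omega>)) (\<lambda>\<omega>. indicator I (X v \<omega>)) =
        covariance M (indicator (?A u)) (indicator (?A v))"
      by (rule covariance_cong_AE) (auto split: split_indicator)
    also have "\<dots> = prob (?A u \<inter> ?A v) - prob (?A u) * prob (?A v)"
      by (rule covariance_indicator) measurable
    also have "?A u \<inter> ?A v = {\<omega> \<in> space M. X u \<omega> \<in> I \<and> X v \<omega> \<in> I}"
      by auto
    finally show "covariance M (\<lambda>\<omega>. indicator I (X u \<omega>)) (\<lambda>\<omega>. indicator I (X v \<omega>)) =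
        \<P>(\<omega> in M. X u \<omega> \<in> I \<and> X v \<omega> \<in> I) - \<P>(\<omega> in M. X u \<omega> \<in> I) * \<P>(\<omega> in M. X v \<omega> \<in> I)" .
  qed
  ultimately show ?thesis by simp
qed

end
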